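(* Let $F:\mathcal{C}\to\mathcal{D}$ be a functor with right adjoint $G:\mathcal{D}\to\mathcal{C}$, unit $\eta:1_{\mathcal{C}}\to GF$ and counit $\varepsilon:FG\to1_{\mathcal{D}}$. 1) Let $H:\mathcal{C}\to\mathcal{E}$ be a functor. An object $M\in\mathcal{C}$ is $F$-relative $H$-injective if and only if $H(\eta_M):H(M)\to HGF(M)$ has a left inverse in $\mathcal{E}$. In particular, $F$ is an $H$-Maschke functor if and only if for every $M\in\mathcal{C}$ the morphism $H(\eta_M)$ has a left inverse in $\mathcal{E}$. 2) Let $H:\mathcal{D}\to\mathcal{E}$ be a functor. An object $P\in\mathcal{D}$ is $G$-relative $H$-projective if and only if $H(\varepsilon_P):HFG(P)\to H(P)$ has a right inverse in $\mathcal{E}$. In particular, $G$ is a dual $H$-Maschke functor if and only if for every $P\in\mathcal{D}$ the morphism $H(\varepsilon_P)$ has a right inverse in $\mathcal{E}$.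
   Context: For functors $F:\mathcal{C}\to\mathcal{D}$ and $H:\mathcal{C}\to\mathcal{E}$: - $M\in\mathcal{C}$ is $F$-relative $H$-injective if for every $i:C\to C'$ in $\mathcal{C}$ such that $F(i)$ is a split monic (has a left inverse) in $\mathcal{D}$, and every $f:C\to M$ in $\mathcal{C}$, there is $g:H(C')\to H(M)$ in $\mathcal{E}$ with $H(f)=g\circ H(i)$. $F$ is $H$-Maschke if every object of $\mathcal{C}$ is $F$-relative $H$-injective. - Dually, $P\in\mathcal{C}$ is $F$-relative $H$-projective if for every $p:C'\to C$ in $\mathcal{C}$ such that $F(p)$ has a right inverse in $\mathcal{D}$, and every $f:P\to C$, there is $g:H(P)\to H(C')$ in $\mathcal{E}$ with $H(f)=H(p)\circ g$. $F$ is dual $H$-Maschke if every object of $\mathcal{C}$ is $F$-relative $H$-projective. *)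

theory Defs
  imports Main
begin

text \<open>
  Arrows carry their domain and codomain. The fields are total functions; their values
  outside \<open>Obj\<close>, \<open>Arr\<close> and (for \<open>Comp\<close>) the composable pairs are unconstrained.
  Composition is in functional order: \<open>g \<cdot>\<^bsub>C\<^esub> f\<close> is ``first \<open>f\<close>, then \<open>g\<close>''.
\<close>

record ('o, 'm) category =
  Obj :: "'o set"
  Arr :: "'m set"
  Dom :: "'m \<Rightarrow> 'o"
  Cod :: "'m \<Rightarrow> 'o"
  Id :: "'o \<Rightarrow> 'm"
  Comp :: "'m \<Rightarrow> 'm \<Rightarrow> 'm" (infixr \<open>\<cdot>\<index>\<close> 70)

definition Hom :: "('o, 'm, 'x) category_scheme \<Rightarrow> 'o \<Rightarrow> 'o \<Rightarrow> 'm set"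
  where "Hom C a b = {f \<in> Arr C. Dom C f = a \<and> Cod C f = b}"

locale category =
  fixes C :: "('o, 'm) category" (structure)
  assumes Dom_in_Obj: "f \<in> Arr C \<Longrightarrow> Dom C f \<in> Obj C"
    and Cod_in_Obj: "f \<in> Arr C \<Longrightarrow> Cod C f \<in> Obj C"
    and Id_in_Hom: "a \<in> Obj C \<Longrightarrow> Id C a \<in> Hom C a a"
    and Comp_in_Hom: "\<lbrakk>f \<in> Hom C a b; g \<in> Hom C b c\<rbrakk> \<Longrightarrow> g \<cdot> f \<in> Hom C a c"
    and Comp_Id_left: "f \<in> Hom C a b \<Longrightarrow> Id C b \<cdot> f = f"
    and Comp_Id_right: "f \<in> Hom C a b \<Longrightarrow> f \<cdot> Id C a = f"
    and Comp_assoc: "\<lbrakk>f \<in> Hom C a b; g \<in> Hom C b c; h \<in> Hom C c d\<rbrakk>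
      \<Longrightarrow> (h \<cdot> g) \<cdot> f = h \<cdot> (g \<cdot> f)"

definition has_left_inverse :: "('o, 'm) category \<Rightarrow> 'm \<Rightarrow> bool"
  where "has_left_inverse C f \<longleftrightarrow>
    f \<in> Arr C \<and> (\<exists>g \<in> Hom C (Cod C f) (Dom C f). g \<cdot>\<^bsub>C\<^esub> f = Id C (Dom C f))"

definition has_right_inverse :: "('o, 'm) category \<Rightarrow> 'm \<Rightarrow> bool"
  where "has_right_inverse C f \<longleftrightarrow>
    f \<in> Arr C \<and> (\<exists>g \<in> Hom C (Cod C f) (Dom C f). f \<cdot>\<^bsub>C\<^esub> g = Id C (Cod C f))"

record ('oc, 'mc, 'od, 'md) functor_data =
  omap :: "'oc \<Rightarrow> 'od"
  amap :: "'mc \<Rightarrow> 'md"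

locale cat_functor = source: category C + target: category D
  for C :: "('oc, 'mc) category" and D :: "('od, 'md) category" +
  fixes F :: "('oc, 'mc, 'od, 'md) functor_data"
  assumes omap_in_Obj: "a \<in> Obj C \<Longrightarrow> omap F a \<in> Obj D"
    and amap_in_Hom: "f \<in> Hom C a b \<Longrightarrow> amap F f \<in> Hom D (omap F a) (omap F b)"
    and amap_Id: "a \<in> Obj C \<Longrightarrow> amap F (Id C a) = Id D (omap F a)"
    and amap_Comp: "\<lbrakk>f \<in> Hom C a b; g \<in> Hom C b c\<rbrakk>
      \<Longrightarrow> amap F (g \<cdot>\<^bsub>C\<^esub> f) = amap F g \<cdot>\<^bsub>D\<^esub> amap F f"

definition id_functor :: "('oc, 'mc, 'oc, 'mc) functor_data"
  where "id_functor = \<lparr>omap = (\<lambda>a. a), amap = (\<lambda>f. f)\<rparr>"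

definition comp_functor :: "('od, 'md, 'oe, 'me) functor_data \<Rightarrow>
    ('oc, 'mc, 'od, 'md) functor_data \<Rightarrow> ('oc, 'mc, 'oe, 'me) functor_data"
  where "comp_functor G F =
    \<lparr>omap = (\<lambda>a. omap G (omap F a)), amap = (\<lambda>f. amap G (amap F f))\<rparr>"

locale nat_trans = dom_functor: cat_functor C D F + cod_functor: cat_functor C D F'
  for C :: "('oc, 'mc) category" and D :: "('od, 'md) category"
    and F F' :: "('oc, 'mc, 'od, 'md) functor_data" +
  fixes \<tau> :: "'oc \<Rightarrow> 'md"
  assumes component_in_Hom: "a \<in> Obj C \<Longrightarrow> \<tau> a \<in> Hom D (omap F a) (omap F' a)"
    and naturality: "f \<in> Hom C a b \<Longrightarrow> \<tau> b \<cdot>\<^bsub>D\<^esub> amap F f = amap F' f \<cdot>\<^bsub>D\<^esub> \<tau> a"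

text \<open>\<open>F\<close> is left adjoint to \<open>G\<close>, with unit \<open>\<eta>\<close> and counit \<open>\<epsilon>\<close> related by the triangle identities.\<close>

locale adjunction =
  left: cat_functor C D F + right: cat_functor D C G +
  unit: nat_trans C C id_functor "comp_functor G F" \<eta> +
  counit: nat_trans D D "comp_functor F G" id_functor \<epsilon>
  for C :: "('oc, 'mc) category" and D :: "('od, 'md) category"
    and F :: "('oc, 'mc, 'od, 'md) functor_data" and G :: "('od, 'md, 'oc, 'mc) functor_data"
    and \<eta> :: "'oc \<Rightarrow> 'mc" and \<epsilon> :: "'od \<Rightarrow> 'md" +
  assumes triangle_left: "a \<in> Obj C \<Longrightarrow> \<epsilon> (omap F a) \<cdot>\<^bsub>D\<^esub> amap F (\<eta> a) = Id D (omap F a)"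
    and triangle_right: "b \<in> Obj D \<Longrightarrow> amap G (\<epsilon> b) \<cdot>\<^bsub>C\<^esub> \<eta> (omap G b) = Id C (omap G b)"

text \<open>
  In the following, \<open>F\<close> is a functor from \<open>C\<close> to \<open>D\<close> and \<open>H\<close> is a functor from \<open>C\<close> to \<open>E\<close>:
  \<open>rel_injective C D F E H M\<close> says that \<open>M\<close> is \<open>F\<close>-relative \<open>H\<close>-injective,
  \<open>Maschke C D F E H\<close> that \<open>F\<close> is \<open>H\<close>-Maschke, and dually.
\<close>

definition rel_injective :: "('oc, 'mc) category \<Rightarrow> ('od, 'md) category \<Rightarrow>
    ('oc, 'mc, 'od, 'md) functor_data \<Rightarrow> ('oe, 'me) category \<Rightarrow>
    ('oc, 'mc, 'oe, 'me) functor_data \<Rightarrow> 'oc \<Rightarrow> bool"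
  where "rel_injective C D F E H M \<longleftrightarrow> M \<in> Obj C \<and>
    (\<forall>A \<in> Obj C. \<forall>A' \<in> Obj C. \<forall>i \<in> Hom C A A'. has_left_inverse D (amap F i) \<longrightarrow>
      (\<forall>f \<in> Hom C A M. \<exists>g \<in> Hom E (omap H A') (omap H M). amap H f = g \<cdot>\<^bsub>E\<^esub> amap H i))"

definition Maschke :: "('oc, 'mc) category \<Rightarrow> ('od, 'md) category \<Rightarrow>
    ('oc, 'mc, 'od, 'md) functor_data \<Rightarrow> ('oe, 'me) category \<Rightarrow>
    ('oc, 'mc, 'oe, 'me) functor_data \<Rightarrow> bool"
  where "Maschke C D F E H \<longleftrightarrow> (\<forall>M \<in> Obj C. rel_injective C D F E H M)"

definition rel_projective :: "('oc, 'mc) category \<Rightarrow> ('od, 'md) category \<Rightarrow>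
    ('oc, 'mc, 'od, 'md) functor_data \<Rightarrow> ('oe, 'me) category \<Rightarrow>
    ('oc, 'mc, 'oe, 'me) functor_data \<Rightarrow> 'oc \<Rightarrow> bool"
  where "rel_projective C D F E H P \<longleftrightarrow> P \<in> Obj C \<and>
    (\<forall>A \<in> Obj C. \<forall>A' \<in> Obj C. \<forall>p \<in> Hom C A' A. has_right_inverse D (amap F p) \<longrightarrow>
      (\<forall>f \<in> Hom C P A. \<exists>g \<in> Hom E (omap H P) (omap H A'). amap H f = amap H p \<cdot>\<^bsub>E\<^esub> g))"

definition dual_Maschke :: "('oc, 'mc) category \<Rightarrow> ('od, 'md) category \<Rightarrow>
    ('oc, 'mc, 'od, 'md) functor_data \<Rightarrow> ('oe, 'me) category \<Rightarrow>
    ('oc, 'mc, 'oe, 'me) functor_data \<Rightarrow> bool"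
  where "dual_Maschke C D F E H \<longleftrightarrow> (\<forall>P \<in> Obj C. rel_projective C D F E H P)"

end

theory Submission
  imports Defs
begin

text \<open>
  The object \<open>M\<close> is injective exactly when its defining extension property can be met for one
  test morphism. The unit \<open>\<eta>\<^sub>M\<close> is such a morphism: \<open>F(\<eta>\<^sub>M)\<close> is split monic, with left inverse
  \<open>\<epsilon>\<^bsub>F(M)\<^esub>\<close>, by a triangle identity, so extending \<open>1\<^sub>M\<close> along \<open>\<eta>\<^sub>M\<close> yields a left inverse of
  \<open>H(\<eta>\<^sub>M)\<close>. It is moreover universal among test morphisms
  (\<open>extension_up_to_unit\<close>): if \<open>F(i)\<close> is split monic, any \<open>f : A \<rightarrow> M\<close> extends along
  \<open>i\<close> after composing it with \<open>\<eta>\<^sub>M\<close>. Applying \<open>H\<close> and cancelling \<open>H(\<eta>\<^sub>M)\<close> by a left inverse then extends \<open>H(f)\<close>.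

  The projective half is dual, with \<open>\<epsilon>\<^sub>P\<close> as universal test morphism
  (\<open>lifting_up_to_counit\<close>). The two Maschke criteria are the objectwise criteria for
  all objects at once.
\<close>

lemma has_left_inverse_iff:
  assumes "f \<in> Hom C a b"
  shows "has_left_inverse C f \<longleftrightarrow> (\<exists>g \<in> Hom C b a. g \<cdot>\<^bsub>C\<^esub> f = Id C a)"
  using assms by (auto simp: has_left_inverse_def Hom_def)

lemma has_right_inverse_iff:
  assumes "f \<in> Hom C a b"
  shows "has_right_inverse C f \<longleftrightarrow> (\<exists>g \<in> Hom C b a. f \<cdot>\<^bsub>C\<^esub> g = Id C b)"
  using assms by (auto simp: has_right_inverse_def Hom_def)

lemma (in category) Hom_objects:
  assumes "f \<in> Hom C a b"
  shows "a \<in> Obj C" "b \<in> Obj C"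
  using assms Dom_in_Obj Cod_in_Obj by (auto simp: Hom_def)

context adjunction
begin

lemma unit_in_Hom: "a \<in> Obj C \<Longrightarrow> \<eta> a \<in> Hom C a (omap G (omap F a))"
  using unit.component_in_Hom by (simp add: id_functor_def comp_functor_def)

lemma counit_in_Hom: "b \<in> Obj D \<Longrightarrow> \<epsilon> b \<in> Hom D (omap F (omap G b)) b"
  using counit.component_in_Hom by (simp add: id_functor_def comp_functor_def)

lemma unit_naturality:
  "f \<in> Hom C a b \<Longrightarrow> \<eta> b \<cdot>\<^bsub>C\<^esub> f = amap G (amap F f) \<cdot>\<^bsub>C\<^esub> \<eta> a"
  using unit.naturality by (simp add: id_functor_def comp_functor_def)

lemma counit_naturality:
  "f \<in> Hom D a b \<Longrightarrow> \<epsilon> b \<cdot>\<^bsub>D\<^esub> amap F (amap G f) = f \<cdot>\<^bsub>D\<^esub> \<epsilon> a"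
  using counit.naturality by (simp add: id_functor_def comp_functor_def)

text \<open>
  If \<open>s\<close> is a left inverse of \<open>F(i)\<close>, then \<open>F(f) \<circ> s\<close> extends \<open>F(f)\<close> along \<open>F(i)\<close>. Its adjoint
  transpose is the required \<open>g\<close>, since \<open>\<eta>\<^sub>M \<circ> f\<close> is the transpose of \<open>F(f)\<close>.
\<close>

lemma extension_up_to_unit:
  assumes i: "i \<in> Hom C A A'" and split: "has_left_inverse D (amap F i)"
    and f: "f \<in> Hom C A M"
  obtains g where "g \<in> Hom C A' (omap G (omap F M))" "g \<cdot>\<^bsub>C\<^esub> i = \<eta> M \<cdot>\<^bsub>C\<^esub> f"
proof -
  note obj = left.source.Hom_objects[OF i]
  note Fi = left.amap_in_Hom[OF i] and Ff = left.amap_in_Hom[OF f]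
  obtain s where s: "s \<in> Hom D (omap F A') (omap F A)"
    and sFi: "s \<cdot>\<^bsub>D\<^esub> amap F i = Id D (omap F A)"
    using split has_left_inverse_iff[OF Fi] by blast
  define h where "h = amap F f \<cdot>\<^bsub>D\<^esub> s"
  have h: "h \<in> Hom D (omap F A') (omap F M)"
    unfolding h_def by (rule left.target.Comp_in_Hom[OF s Ff])
  have hFi: "h \<cdot>\<^bsub>D\<^esub> amap F i = amap F f"
    unfolding h_def
    by (simp add: left.target.Comp_assoc[OF Fi s Ff] sFi left.target.Comp_Id_right[OF Ff])
  note Gh = right.amap_in_Hom[OF h] and GFi = right.amap_in_Hom[OF Fi]
  show thesis
  proof (rule that)
    show "amap G h \<cdot>\<^bsub>C\<^esub> \<eta> A' \<in> Hom C A' (omap G (omap F M))"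
      by (rule left.source.Comp_in_Hom[OF unit_in_Hom[OF obj(2)] Gh])
    have "(amap G h \<cdot>\<^bsub>C\<^esub> \<eta> A') \<cdot>\<^bsub>C\<^esub> i = amap G h \<cdot>\<^bsub>C\<^esub> (amap G (amap F i) \<cdot>\<^bsub>C\<^esub> \<eta> A)"
      by (simp add: left.source.Comp_assoc[OF i unit_in_Hom[OF obj(2)] Gh] unit_naturality[OF i])
    also have "\<dots> = amap G (h \<cdot>\<^bsub>D\<^esub> amap F i) \<cdot>\<^bsub>C\<^esub> \<eta> A"
      by (simp add: left.source.Comp_assoc[OF unit_in_Hom[OF obj(1)] GFi Gh]
          right.amap_Comp[OF Fi h])
    also have "\<dots> = \<eta> M \<cdot>\<^bsub>C\<^esub> f"
      by (simp add: hFi unit_naturality[OF f])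
    finally show "(amap G h \<cdot>\<^bsub>C\<^esub> \<eta> A') \<cdot>\<^bsub>C\<^esub> i = \<eta> M \<cdot>\<^bsub>C\<^esub> f" .
  qed
qed

text \<open>
  Dually, if \<open>t\<close> is a right inverse of \<open>G(p)\<close>, then \<open>t \<circ> G(f)\<close> lifts \<open>G(f)\<close> along \<open>G(p)\<close>, and \<open>g\<close>
  is its adjoint transpose.
\<close>

lemma lifting_up_to_counit:
  assumes p: "p \<in> Hom D A' A" and split: "has_right_inverse C (amap G p)"
    and f: "f \<in> Hom D P A"
  obtains g where "g \<in> Hom D (omap F (omap G P)) A'" "p \<cdot>\<^bsub>D\<^esub> g = f \<cdot>\<^bsub>D\<^esub> \<epsilon> P"
proof -
  note obj = left.target.Hom_objects[OF p]
  note Gp = right.amap_in_Hom[OF p] and Gf = right.amap_in_Hom[OF f]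
  obtain t where t: "t \<in> Hom C (omap G A) (omap G A')"
    and Gpt: "amap G p \<cdot>\<^bsub>C\<^esub> t = Id C (omap G A)"
    using split has_right_inverse_iff[OF Gp] by blast
  define h where "h = t \<cdot>\<^bsub>C\<^esub> amap G f"
  have h: "h \<in> Hom C (omap G P) (omap G A')"
    unfolding h_def by (rule left.source.Comp_in_Hom[OF Gf t])
  have Gph: "amap G p \<cdot>\<^bsub>C\<^esub> h = amap G f"
    unfolding h_def
    by (simp add: left.source.Comp_assoc[OF Gf t Gp, symmetric] Gpt
        left.source.Comp_Id_left[OF Gf])
  note Fh = left.amap_in_Hom[OF h] and FGp = left.amap_in_Hom[OF Gp]
  show thesis
  proof (rule that)
    show "\<epsilon> A' \<cdot>\<^bsub>D\<^esub> amap F h \<in> Hom D (omap F (omap G P)) A'"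
      by (rule left.target.Comp_in_Hom[OF Fh counit_in_Hom[OF obj(1)]])
    have "p \<cdot>\<^bsub>D\<^esub> (\<epsilon> A' \<cdot>\<^bsub>D\<^esub> amap F h) = (\<epsilon> A \<cdot>\<^bsub>D\<^esub> amap F (amap G p)) \<cdot>\<^bsub>D\<^esub> amap F h"
      by (simp add: left.target.Comp_assoc[OF Fh counit_in_Hom[OF obj(1)] p, symmetric]
          counit_naturality[OF p])
    also have "\<dots> = \<epsilon> A \<cdot>\<^bsub>D\<^esub> amap F (amap G p \<cdot>\<^bsub>C\<^esub> h)"
      by (simp add: left.target.Comp_assoc[OF Fh FGp counit_in_Hom[OF obj(2)]]
          left.amap_Comp[OF h Gp])
    also have "\<dots> = f \<cdot>\<^bsub>D\<^esub> \<epsilon> P"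
      by (simp add: Gph counit_naturality[OF f])
    finally show "p \<cdot>\<^bsub>D\<^esub> (\<epsilon> A' \<cdot>\<^bsub>D\<^esub> amap F h) = f \<cdot>\<^bsub>D\<^esub> \<epsilon> P" .
  qed
qed

text \<open>
  Testing injectivity on \<open>i = \<eta>\<^sub>M\<close> and \<open>f = 1\<^sub>M\<close> gives a left inverse \<open>r\<close> of \<open>H(\<eta>\<^sub>M)\<close>. Conversely,
  \<open>g \<circ> i = \<eta>\<^sub>M \<circ> f\<close> gives \<open>(r \<circ> H(g)) \<circ> H(i) = r \<circ> H(\<eta>\<^sub>M) \<circ> H(f) = H(f)\<close>.
\<close>

theorem rel_injective_iff_unit_split:
  assumes "cat_functor C E H" and M: "M \<in> Obj C"
  shows "rel_injective C D F E H M \<longleftrightarrow> has_left_inverse E (amap H (\<eta> M))"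
proof -
  interpret H: cat_functor C E H by fact
  note unit = unit_in_Hom[OF M]
  note Hunit = H.amap_in_Hom[OF unit]
  note FM = left.omap_in_Obj[OF M]
  show ?thesis
  proof
    assume inj: "rel_injective C D F E H M"
    have "has_left_inverse D (amap F (\<eta> M))"
      using has_left_inverse_iff[OF left.amap_in_Hom[OF unit]] counit_in_Hom[OF FM]
        triangle_left[OF M] by blast
    then obtain g where "g \<in> Hom E (omap H (omap G (omap F M))) (omap H M)"
      and "amap H (Id C M) = g \<cdot>\<^bsub>E\<^esub> amap H (\<eta> M)"
      using inj M unit right.omap_in_Obj[OF FM] left.source.Id_in_Hom[OF M]
      unfolding rel_injective_def by blast
    then show "has_left_inverse E (amap H (\<eta> M))"
      using has_left_inverse_iff[OF Hunit] H.amap_Id[OF M] by auto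
  next
    assume "has_left_inverse E (amap H (\<eta> M))"
    then obtain r where r: "r \<in> Hom E (omap H (omap G (omap F M))) (omap H M)"
      and r_unit: "r \<cdot>\<^bsub>E\<^esub> amap H (\<eta> M) = Id E (omap H M)"
      using has_left_inverse_iff[OF Hunit] by blast
    have "\<exists>k \<in> Hom E (omap H A') (omap H M). amap H f = k \<cdot>\<^bsub>E\<^esub> amap H i"
      if i: "i \<in> Hom C A A'" and split: "has_left_inverse D (amap F i)"
        and f: "f \<in> Hom C A M" for A A' i f
    proof -
      obtain g where g: "g \<in> Hom C A' (omap G (omap F M))"
        and gi: "g \<cdot>\<^bsub>C\<^esub> i = \<eta> M \<cdot>\<^bsub>C\<^esub> f"
        by (rule extension_up_to_unit[OF i split f])
      note Hi = H.amap_in_Hom[OF i] and Hf = H.amap_in_Hom[OF f] and Hg = H.amap_in_Hom[OF g]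
      have "(r \<cdot>\<^bsub>E\<^esub> amap H g) \<cdot>\<^bsub>E\<^esub> amap H i = r \<cdot>\<^bsub>E\<^esub> amap H (\<eta> M \<cdot>\<^bsub>C\<^esub> f)"
        by (simp add: H.target.Comp_assoc[OF Hi Hg r] H.amap_Comp[OF i g, symmetric] gi)
      also have "\<dots> = (r \<cdot>\<^bsub>E\<^esub> amap H (\<eta> M)) \<cdot>\<^bsub>E\<^esub> amap H f"
        by (simp add: H.target.Comp_assoc[OF Hf Hunit r] H.amap_Comp[OF f unit])
      also have "\<dots> = amap H f"
        by (simp add: r_unit H.target.Comp_Id_left[OF Hf])
      finally have "amap H f = (r \<cdot>\<^bsub>E\<^esub> amap H g) \<cdot>\<^bsub>E\<^esub> amap H i" ..
      with H.target.Comp_in_Hom[OF Hg r] show ?thesis by blast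
    qed
    with M show "rel_injective C D F E H M" unfolding rel_injective_def by blast
  qed
qed

text \<open>
  Testing projectivity on \<open>p = \<epsilon>\<^sub>P\<close> and \<open>f = 1\<^sub>P\<close> gives a right inverse \<open>r\<close> of \<open>H(\<epsilon>\<^sub>P)\<close>. Conversely,
  \<open>p \<circ> g = f \<circ> \<epsilon>\<^sub>P\<close> gives \<open>H(p) \<circ> (H(g) \<circ> r) = H(f) \<circ> H(\<epsilon>\<^sub>P) \<circ> r = H(f)\<close>.
\<close>

theorem rel_projective_iff_counit_split:
  assumes "cat_functor D E H" and P: "P \<in> Obj D"
  shows "rel_projective D C G E H P \<longleftrightarrow> has_right_inverse E (amap H (\<epsilon> P))"
proof -
  interpret H: cat_functor D E H by fact
  note counit = counit_in_Hom[OF P]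
  note Hcounit = H.amap_in_Hom[OF counit]
  note GP = right.omap_in_Obj[OF P]
  show ?thesis
  proof
    assume proj: "rel_projective D C G E H P"
    have "has_right_inverse C (amap G (\<epsilon> P))"
      using has_right_inverse_iff[OF right.amap_in_Hom[OF counit]] unit_in_Hom[OF GP]
        triangle_right[OF P] by blast
    then obtain g where "g \<in> Hom E (omap H P) (omap H (omap F (omap G P)))"
      and "amap H (Id D P) = amap H (\<epsilon> P) \<cdot>\<^bsub>E\<^esub> g"
      using proj P counit left.omap_in_Obj[OF GP] left.target.Id_in_Hom[OF P]
      unfolding rel_projective_def by blast
    then show "has_right_inverse E (amap H (\<epsilon> P))"
      using has_right_inverse_iff[OF Hcounit] H.amap_Id[OF P] by auto
  next
    assume "has_right_inverse E (amap H (\<epsilon> P))"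
    then obtain r where r: "r \<in> Hom E (omap H P) (omap H (omap F (omap G P)))"
      and counit_r: "amap H (\<epsilon> P) \<cdot>\<^bsub>E\<^esub> r = Id E (omap H P)"
      using has_right_inverse_iff[OF Hcounit] by blast
    have "\<exists>k \<in> Hom E (omap H P) (omap H A'). amap H f = amap H p \<cdot>\<^bsub>E\<^esub> k"
      if p: "p \<in> Hom D A' A" and split: "has_right_inverse C (amap G p)"
        and f: "f \<in> Hom D P A" for A A' p f
    proof -
      obtain g where g: "g \<in> Hom D (omap F (omap G P)) A'"
        and pg: "p \<cdot>\<^bsub>D\<^esub> g = f \<cdot>\<^bsub>D\<^esub> \<epsilon> P"
        by (rule lifting_up_to_counit[OF p split f])
      note Hp = H.amap_in_Hom[OF p] and Hf = H.amap_in_Hom[OF f] and Hg = H.amap_in_Hom[OF g]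
      have "amap H p \<cdot>\<^bsub>E\<^esub> (amap H g \<cdot>\<^bsub>E\<^esub> r) = amap H (f \<cdot>\<^bsub>D\<^esub> \<epsilon> P) \<cdot>\<^bsub>E\<^esub> r"
        by (simp add: H.target.Comp_assoc[OF r Hg Hp, symmetric]
            H.amap_Comp[OF g p, symmetric] pg)
      also have "\<dots> = amap H f \<cdot>\<^bsub>E\<^esub> (amap H (\<epsilon> P) \<cdot>\<^bsub>E\<^esub> r)"
        by (simp add: H.target.Comp_assoc[OF r Hcounit Hf] H.amap_Comp[OF counit f])
      also have "\<dots> = amap H f"
        by (simp add: counit_r H.target.Comp_Id_right[OF Hf])
      finally have "amap H f = amap H p \<cdot>\<^bsub>E\<^esub> (amap H g \<cdot>\<^bsub>E\<^esub> r)" ..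
      with H.target.Comp_in_Hom[OF r Hg] show ?thesis by blast
    qed
    with P show "rel_projective D C G E H P" unfolding rel_projective_def by blast
  qed
qed

end

theorem theorem4p4:
  fixes C :: "('oc, 'mc) category" and D :: "('od, 'md) category"
    and F :: "('oc, 'mc, 'od, 'md) functor_data" and G :: "('od, 'md, 'oc, 'mc) functor_data"
    and \<eta> :: "'oc \<Rightarrow> 'mc" and \<epsilon> :: "'od \<Rightarrow> 'md"
  assumes "adjunction C D F G \<eta> \<epsilon>"
  shows
    "(\<forall>(E :: ('oe, 'me) category) (H :: ('oc, 'mc, 'oe, 'me) functor_data).
        cat_functor C E H \<longrightarrow>
          (\<forall>M \<in> Obj C. rel_injective C D F E H M \<longleftrightarrow> has_left_inverse E (amap H (\<eta> M))) \<and>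
          (Maschke C D F E H \<longleftrightarrow> (\<forall>M \<in> Obj C. has_left_inverse E (amap H (\<eta> M))))) \<and>
     (\<forall>(E :: ('oe2, 'me2) category) (H :: ('od, 'md, 'oe2, 'me2) functor_data).
        cat_functor D E H \<longrightarrow>
          (\<forall>P \<in> Obj D. rel_projective D C G E H P \<longleftrightarrow> has_right_inverse E (amap H (\<epsilon> P))) \<and>
          (dual_Maschke D C G E H \<longleftrightarrow> (\<forall>P \<in> Obj D. has_right_inverse E (amap H (\<epsilon> P)))))"
proof -
  interpret adjunction C D F G \<eta> \<epsilon> by fact
  show ?thesis
    unfolding Maschke_def dual_Maschke_def
    by (simp add: rel_injective_iff_unit_split rel_projective_iff_counit_split)
qed

end
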